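(* For each $n$ let $C_n,T_n$ be random partitions of $[n]$ (defined on a common probability space) such that $\mathbb{P}(C_n\preceq T_n)\to1$, and suppose that $1\ll\mathbb{E}[m_{T_n}]\ll n^2$ and $m_{T_n}/\mathbb{E}[m_{T_n}]\to1$ in probability. Then $$\rho(C_n,T_n)-\sqrt{\frac{m_{C_n}}{\mathbb{E}[m_{T_n}]}}\ \longrightarrow\ 0\quad\text{in probability as }n\to\infty.$$
   Context: Asymptotics are as $n\to\infty$; $a_n\ll b_n$ means $a_n/b_n\to0$; $[n]=\{1,\dots,n\}$. For a partition $T$ of $[n]$, $i\stackrel{T}{\sim}j$ means $i,j$ are in the same block, and $m_T=\#\{1\le i<j\le n: i\stackrel{T}{\sim}j\}$. For partitions $C,T$ of $[n]$, $C\preceq T$ ($C$ is a refinement of $T$) means that $i\stackrel{C}{\sim}j$ implies $i\stackrel{T}{\sim}j$ for all $i,j\in[n]$. Correlation: with $N=\binom n2$ and $m_{CT}=\#\{i<j: i\stackrel{C}{\sim}j\text{ and }i\stackrel{T}{\sim}j\}$, $$\rho(C,T)=\frac{m_{CT}N-m_Cm_T}{\sqrt{m_C(N-m_C)m_T(N-m_T)}}.$$ If the denominator vanishes, set $\rho(C,T)=1$ if $C=T$, $\rho(C,T)=-1$ if one of $C,T$ is the single-block partition and the other is the all-singletons partition with $n\ge2$, and $\rho(C,T)=0$ otherwise. *)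

theory Defs
  imports
    "HOL-Library.Disjoint_Sets"
    "HOL-Library.Landau_Symbols"
    "HOL-Probability.Probability"
begin

definition partitions :: "nat \<Rightarrow> nat set set set" where
  "partitions n = {P. partition_on {1..n} P}"

definition same_block :: "nat set set \<Rightarrow> nat \<Rightarrow> nat \<Rightarrow> bool" where
  "same_block P i j \<longleftrightarrow> (\<exists>B\<in>P. i \<in> B \<and> j \<in> B)"

text \<open>The library relation \<open>refines\<close> compares blocks; on partitions it is inclusion of the
  same-block relations.\<close>

lemma refines_iff_same_block:
  assumes C: "partition_on A C" and T: "partition_on A T"
  shows "refines A C T \<longleftrightarrow> (\<forall>i\<in>A. \<forall>j\<in>A. same_block C i j \<longrightarrow> same_block T i j)"
proof
  assume "refines A C T"
  then have sub: "\<And>X. X \<in> C \<Longrightarrow> \<exists>Y\<in>T. X \<subseteq> Y"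
    by (simp add: refines_def)
  show "\<forall>i\<in>A. \<forall>j\<in>A. same_block C i j \<longrightarrow> same_block T i j"
  proof (intro ballI impI)
    fix i j assume "same_block C i j"
    then obtain X where X: "X \<in> C" "i \<in> X" "j \<in> X" unfolding same_block_def by (elim bexE conjE)
    obtain Y where Y: "Y \<in> T" "X \<subseteq> Y" using sub[OF X(1)] by (elim bexE)
    have "i \<in> Y" "j \<in> Y" using Y(2) X(2,3) by (simp_all add: subsetD)
    with Y(1) show "same_block T i j" unfolding same_block_def by (intro bexI conjI)
  qed
next
  assume rel: "\<forall>i\<in>A. \<forall>j\<in>A. same_block C i j \<longrightarrow> same_block T i j"
  have "\<exists>Y\<in>T. X \<subseteq> Y" if X: "X \<in> C" for X
  proof -
    have XA: "X \<subseteq> A" using partition_onD1[OF C] X by blast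
    have "X \<noteq> {}" using partition_onD3[OF C] X by blast
    then obtain x where x: "x \<in> X" by blast
    have "x \<in> \<Union>T" using partition_onD1[OF T] x XA by blast
    then obtain Y where Y: "Y \<in> T" "x \<in> Y" by blast
    have "y \<in> Y" if "y \<in> X" for y
    proof -
      have "x \<in> A" "y \<in> A" using x XA that by (simp_all add: subsetD)
      moreover have "same_block C x y"
        unfolding same_block_def using X x that by (intro bexI conjI)
      ultimately have "same_block T x y" by (rule rel[rule_format])
      then obtain Z where Z: "Z \<in> T" "x \<in> Z" "y \<in> Z" unfolding same_block_def by (elim bexE conjE)
      have "Z = Y" using disjointD[OF partition_onD2[OF T] Z(1) Y(1)] Z(2) Y(2) by blast
      then show ?thesis using Z(3) by simp
    qed
    then show ?thesis using Y by blast
  qed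
  then show "refines A C T" using C T by (simp add: refines_def)
qed

definition m_pairs :: "nat \<Rightarrow> nat set set \<Rightarrow> nat" where
  "m_pairs n T = card {(i, j). 1 \<le> i \<and> i < j \<and> j \<le> n \<and> same_block T i j}"

definition m_common :: "nat \<Rightarrow> nat set set \<Rightarrow> nat set set \<Rightarrow> nat" where
  "m_common n C T =
     card {(i, j). 1 \<le> i \<and> i < j \<and> j \<le> n \<and> same_block C i j \<and> same_block T i j}"

definition single_block :: "nat \<Rightarrow> nat set set" where
  "single_block n = {{1..n}}"

definition all_singletons :: "nat \<Rightarrow> nat set set" where
  "all_singletons n = (\<lambda>i. {i}) ` {1..n}"

definition rho :: "nat \<Rightarrow> nat set set \<Rightarrow> nat set set \<Rightarrow> real" where
  "rho n C T =
    (let N = real (n choose 2);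
         mC = real (m_pairs n C);
         mT = real (m_pairs n T);
         mCT = real (m_common n C T);
         denom = sqrt (mC * (N - mC) * mT * (N - mT))
     in if denom \<noteq> 0 then (mCT * N - mC * mT) / denom
        else if C = T then 1
        else if n \<ge> 2 \<and> (C = single_block n \<and> T = all_singletons n \<or>
                          C = all_singletons n \<and> T = single_block n) then - 1
        else 0)"

text \<open>Convergence in probability to a constant; the probability space may change with the index.\<close>

definition tendsto_in_prob :: "(nat \<Rightarrow> 'a measure) \<Rightarrow> (nat \<Rightarrow> 'a \<Rightarrow> real) \<Rightarrow> real \<Rightarrow> bool" where
  "tendsto_in_prob M X c \<longleftrightarrow>
     (\<forall>\<epsilon>>0. (\<lambda>n. measure (M n) {\<omega> \<in> space (M n). \<bar>X n \<omega> - c\<bar> > \<epsilon>}) \<longlonglongrightarrow> 0)"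

end

theory Submission
  imports Defs
begin

text \<open>Write \<open>m\<^sub>C\<close>, \<open>m\<^sub>T\<close> for the numbers of pairs inside blocks, \<open>N = n choose 2\<close>, and
  \<open>\<mu> = E[m\<^sub>T]\<close>. If \<open>C\<close> refines \<open>T\<close>, every pair inside a block of \<open>C\<close> is inside a block of
  \<open>T\<close>, so \<open>m\<^sub>C\<^sub>T = m\<^sub>C\<close> and, for \<open>0 < m\<^sub>C\<close> and \<open>m\<^sub>T < N\<close>, the correlation factorises as
  \<open>\<rho> = sqrt (m\<^sub>C / m\<^sub>T) * sqrt ((N - m\<^sub>T) / (N - m\<^sub>C))\<close>. The target is
  \<open>sqrt (m\<^sub>C / \<mu>) = sqrt (m\<^sub>C / m\<^sub>T) * sqrt (m\<^sub>T / \<mu>)\<close>. The common factor is at most 1, and both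
  remaining factors are close to 1, because \<open>m\<^sub>T / N\<close> and \<open>m\<^sub>T / \<mu> - 1\<close> are small. Quantitatively,
  \<open>\<bar>\<rho> - sqrt (m\<^sub>C / \<mu>)\<bar> \<le> m\<^sub>T / N + \<bar>m\<^sub>T / \<mu> - 1\<bar>\<close> whenever \<open>0 < m\<^sub>T < N\<close>
  (lemma \<open>rho_refinement_error\<close>). This holds outcome by outcome, and for \<open>m\<^sub>C = 0\<close> as well.

  The probabilistic part is then a union bound. As \<open>\<mu> \<lless> n\<^sup>2\<close>, the right-hand side is small for all
  large \<open>n\<close> as soon as \<open>m\<^sub>T / \<mu>\<close> is near 1. Hence a deviation by more than \<open>\<epsilon>\<close> forces one of
  two events, a failure of refinement or a deviation of \<open>m\<^sub>T / \<mu>\<close> from 1, whose probabilities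
  tend to 0.\<close>

section \<open>Pairs inside blocks\<close>

lemma finite_pairs_below: "finite {(i, j). 1 \<le> i \<and> i < j \<and> j \<le> (n::nat) \<and> P i j}"
  by (rule finite_subset[of _ "{1..n} \<times> {1..n}"]) auto

lemma card_pairs_below: "card {(i, j). 1 \<le> i \<and> i < j \<and> j \<le> (n::nat)} = n choose 2"
proof (induction n)
  case 0
  have "{(i, j). 1 \<le> i \<and> i < j \<and> j \<le> (0::nat)} = {}" by auto
  then have "card {(i, j). 1 \<le> i \<and> i < j \<and> j \<le> (0::nat)} = 0" by (simp only: card.empty)
  then show ?case by simp
next
  case (Suc n)
  let ?S = "\<lambda>n::nat. {(i, j). 1 \<le> i \<and> i < j \<and> j \<le> n}"
  have "?S (Suc n) = ?S n \<union> (\<lambda>i. (i, Suc n)) ` {1..n}" by auto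
  moreover have "card (?S n \<union> (\<lambda>i. (i, Suc n)) ` {1..n}) = card (?S n) + card ((\<lambda>i. (i, Suc n)) ` {1..n})"
    using finite_pairs_below[of n "\<lambda>_ _. True"] by (intro card_Un_disjoint) auto
  moreover have "card ((\<lambda>i. (i, Suc n)) ` {1..n}) = n"
    by (subst card_image) (auto simp: inj_on_def)
  ultimately show ?case using Suc by (simp add: numeral_2_eq_2)
qed

lemma m_pairs_single_block: "m_pairs n (single_block n) = n choose 2"
proof -
  have "{(i, j). 1 \<le> i \<and> i < j \<and> j \<le> n \<and> same_block (single_block n) i j}
      = {(i, j). 1 \<le> i \<and> i < j \<and> j \<le> n}"
    by (auto simp: same_block_def single_block_def)
  then show ?thesis unfolding m_pairs_def by (simp only: card_pairs_below)
qed

lemma m_pairs_all_singletons: "m_pairs n (all_singletons n) = 0"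
proof -
  have "{(i, j). 1 \<le> i \<and> i < j \<and> j \<le> n \<and> same_block (all_singletons n) i j} = {}"
    by (auto simp: same_block_def all_singletons_def)
  then show ?thesis unfolding m_pairs_def by (simp only: card.empty)
qed

lemma same_block_refines:
  assumes "refines A C T" "same_block C i j"
  shows "same_block T i j"
  using assms unfolding refines_def same_block_def by blast

lemma m_pairs_mono_refines:
  assumes "refines {1..n} C T"
  shows "m_pairs n C \<le> m_pairs n T"
  unfolding m_pairs_def
  by (rule card_mono[OF finite_pairs_below]) (auto intro: same_block_refines[OF assms])

lemma m_common_refines:
  assumes "refines {1..n} C T"
  shows "m_common n C T = m_pairs n C"
  unfolding m_common_def m_pairs_def
  by (rule arg_cong[where f = card]) (auto intro: same_block_refines[OF assms])

section \<open>The correlation of a partition with a refinement\<close>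

lemma abs_sqrt_minus_one_le:
  fixes x :: real
  assumes "x \<ge> 0"
  shows "\<bar>sqrt x - 1\<bar> \<le> \<bar>x - 1\<bar>"
proof -
  have "x - 1 = (sqrt x - 1) * (sqrt x + 1)"
    using assms by (simp add: algebra_simps)
  then have "\<bar>x - 1\<bar> = \<bar>sqrt x - 1\<bar> * (sqrt x + 1)"
    using assms by (simp add: abs_mult)
  moreover have "\<bar>sqrt x - 1\<bar> * 1 \<le> \<bar>sqrt x - 1\<bar> * (sqrt x + 1)"
    using assms by (intro mult_left_mono) auto
  ultimately show ?thesis by simp
qed

text \<open>The left-hand side factors as \<open>sqrt (c / t)\<close> times
  \<open>sqrt ((N - t) / (N - c)) - sqrt (t / \<mu>)\<close>. The first factor is at most 1, and in the second both
  roots are compared with 1; since \<open>0 \<le> c \<le> t\<close>, the ratio \<open>(N - t) / (N - c)\<close> lies between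
  \<open>1 - t / N\<close> and 1.\<close>

lemma correlation_error_real:
  fixes c t N \<mu> :: real
  assumes "0 < c" "c \<le> t" "t < N" "0 < \<mu>"
  shows "\<bar>(c * N - c * t) / sqrt (c * (N - c) * t * (N - t)) - sqrt (c / \<mu>)\<bar>
           \<le> t / N + \<bar>t / \<mu> - 1\<bar>"
proof -
  define s where "s = (N - t) / (N - c)"
  have pos: "t > 0" "N > 0" "N - t > 0" "N - c > 0" using assms by auto
  have "(c * N - c * t) / sqrt (c * (N - c) * t * (N - t)) = sqrt (c / t) * sqrt s"
  proof -
    have "c * N - c * t = (sqrt c * sqrt (N - t)) * (sqrt c * sqrt (N - t))"
      using assms pos by (simp add: algebra_simps flip: real_sqrt_mult)
    moreover have "sqrt (c * (N - c) * t * (N - t)) = (sqrt c * sqrt (N - t)) * (sqrt t * sqrt (N - c))"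
      by (simp add: real_sqrt_mult)
    ultimately show ?thesis
      using assms pos by (simp add: s_def real_sqrt_divide)
  qed
  moreover have "sqrt (c / \<mu>) = sqrt (c / t) * sqrt (t / \<mu>)"
    using pos by (simp flip: real_sqrt_mult)
  ultimately have "\<bar>(c * N - c * t) / sqrt (c * (N - c) * t * (N - t)) - sqrt (c / \<mu>)\<bar>
      = sqrt (c / t) * \<bar>sqrt s - sqrt (t / \<mu>)\<bar>"
    using assms pos by (simp add: abs_mult flip: right_diff_distrib)
  also have "\<dots> \<le> 1 * \<bar>sqrt s - sqrt (t / \<mu>)\<bar>"
    using assms pos by (intro mult_right_mono) auto
  also have "\<dots> \<le> \<bar>sqrt s - 1\<bar> + \<bar>sqrt (t / \<mu>) - 1\<bar>"
  proof -
    have "\<bar>a - b\<bar> \<le> \<bar>a - 1\<bar> + \<bar>b - 1\<bar>" for a b :: real by linarith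
    then show ?thesis unfolding mult_1_left .
  qed
  also have "\<dots> \<le> \<bar>s - 1\<bar> + \<bar>t / \<mu> - 1\<bar>"
    using assms pos by (intro add_mono abs_sqrt_minus_one_le) (auto simp: s_def)
  also have "\<bar>s - 1\<bar> \<le> t / N"
  proof -
    have "s \<le> 1" using assms pos by (simp add: s_def)
    moreover have "1 - t / N = (N - t) / N" using pos by (simp add: field_simps)
    moreover have "(N - t) / N \<le> s"
      unfolding s_def using assms pos by (intro divide_left_mono) auto
    ultimately show ?thesis by linarith
  qed
  finally show ?thesis by simp
qed

text \<open>If \<open>m\<^sub>C = 0\<close>, the correlation is defined by convention. The bounds on \<open>m\<^sub>T\<close> exclude the
  conventional values 1 and -1, so the correlation is 0, which is also the value of the square
  root.\<close>

lemma rho_refinement_error: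
  assumes ref: "refines {1..n} C T"
    and T: "0 < m_pairs n T" "m_pairs n T < n choose 2"
    and \<mu>: "0 < \<mu>"
  shows "\<bar>rho n C T - sqrt (real (m_pairs n C) / \<mu>)\<bar>
           \<le> real (m_pairs n T) / real (n choose 2) + \<bar>real (m_pairs n T) / \<mu> - 1\<bar>"
proof (cases "m_pairs n C = 0")
  case True
  have "C \<noteq> T" using True T by auto
  moreover have "T \<noteq> all_singletons n" using T m_pairs_all_singletons[of n] by auto
  moreover have "T \<noteq> single_block n" using T m_pairs_single_block[of n] by auto
  ultimately have "rho n C T = 0" using True by (simp add: rho_def)
  then show ?thesis using True by simp
next
  case False
  let ?c = "real (m_pairs n C)" and ?t = "real (m_pairs n T)" and ?N = "real (n choose 2)"
  have le: "?c \<le> ?t" using m_pairs_mono_refines[OF ref] by simp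
  have lt: "?t < ?N" using T by simp
  have c: "0 < ?c" using False by simp
  have "sqrt (?c * (?N - ?c) * ?t * (?N - ?t)) \<noteq> 0" using le lt c by simp
  then have "rho n C T = (?c * ?N - ?c * ?t) / sqrt (?c * (?N - ?c) * ?t * (?N - ?t))"
    unfolding rho_def Let_def m_common_refines[OF ref] by (rule if_P)
  then show ?thesis using correlation_error_real[OF c le lt \<mu>] by simp
qed

section \<open>Random partitions\<close>

lemma finite_partitions: "finite (partitions n)"
  by (rule finite_subset[of _ "Pow (Pow {1..n})"]) (auto simp: partitions_def partition_on_def)

text \<open>Only finitely many pairs of partitions exist, so every event determined by two random
  partitions is measurable.\<close>

lemma sets_Collect_random_partitions:
  assumes "C \<in> measurable M (count_space (partitions n))"
    and "T \<in> measurable M (count_space (partitions n))"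
  shows "{\<omega> \<in> space M. P (C \<omega>) (T \<omega>)} \<in> sets M"
proof -
  have "{\<omega> \<in> space M. P (C \<omega>) (T \<omega>)} =
      (\<Union>(c, t)\<in>{(c, t). c \<in> partitions n \<and> t \<in> partitions n \<and> P c t}.
         (C -` {c} \<inter> space M) \<inter> (T -` {t} \<inter> space M))"
    using measurable_space[OF assms(1)] measurable_space[OF assms(2)] by auto
  also have "\<dots> \<in> sets M"
  proof (rule sets.finite_UN)
    show "finite {(c, t). c \<in> partitions n \<and> t \<in> partitions n \<and> P c t}"
      by (rule finite_subset[of _ "partitions n \<times> partitions n"]) (auto simp: finite_partitions)
    show "(case x of (c, t) \<Rightarrow> (C -` {c} \<inter> space M) \<inter> (T -` {t} \<inter> space M)) \<in> sets M"
      if "x \<in> {(c, t). c \<in> partitions n \<and> t \<in> partitions n \<and> P c t}" for x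
      using that by (auto intro!: sets.Int measurable_sets[OF assms(1)] measurable_sets[OF assms(2)])
  qed
  finally show ?thesis .
qed

section \<open>Convergence in probability\<close>

lemma eventually_smallo_choose_two:
  assumes "f \<in> o(\<lambda>n. real n ^ 2)" and "0 < (\<eta>::real)"
  shows "eventually (\<lambda>n. \<bar>f n\<bar> \<le> \<eta> * real (n choose 2)) sequentially"
proof -
  have "eventually (\<lambda>n. \<bar>f n\<bar> \<le> \<eta> / 4 * real n ^ 2) sequentially"
    using landau_o.smallD[OF assms(1), of "\<eta> / 4"] assms(2) by simp
  then show ?thesis
    using eventually_ge_at_top[of 2]
  proof eventually_elim
    case (elim n)
    have N: "real (n choose 2) = real n * (real n - 1) / 2"
      using elim(2) by (simp add: choose_two real_of_nat_div of_nat_diff)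
    have "real n * 2 \<le> real n * real n" using elim(2) by (intro mult_left_mono) auto
    \<comment> \<open>\<open>n\<^sup>2 / 4 \<le> n (n - 1) / 2\<close> from \<open>n \<ge> 2\<close> on; this is the source of the constant 4.\<close>
    then have "real n ^ 2 / 4 \<le> real (n choose 2)"
      unfolding N by (simp add: power2_eq_square field_simps)
    then have "\<eta> * (real n ^ 2 / 4) \<le> \<eta> * real (n choose 2)"
      using assms(2) by (intro mult_left_mono) auto
    then show ?case using elim(1) by simp
  qed
qed

theorem lemma3p5:
  fixes M :: "nat \<Rightarrow> 'a measure"
    and C T :: "nat \<Rightarrow> 'a \<Rightarrow> nat set set"
  assumes "\<And>n. prob_space (M n)"
    and "\<And>n. C n \<in> measurable (M n) (count_space (partitions n))"
    and "\<And>n. T n \<in> measurable (M n) (count_space (partitions n))"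
    and "(\<lambda>n. measure (M n) {\<omega> \<in> space (M n). refines {1..n} (C n \<omega>) (T n \<omega>)}) \<longlonglongrightarrow> 1"
    and "(\<lambda>_. 1) \<in> o(\<lambda>n. \<integral>\<omega>. real (m_pairs n (T n \<omega>)) \<partial>(M n))"
    and "(\<lambda>n. \<integral>\<omega>. real (m_pairs n (T n \<omega>)) \<partial>(M n)) \<in> o(\<lambda>n. real n ^ 2)"
    and "tendsto_in_prob M
           (\<lambda>n \<omega>. real (m_pairs n (T n \<omega>)) / (\<integral>\<omega>'. real (m_pairs n (T n \<omega>')) \<partial>(M n))) 1"
  shows "tendsto_in_prob M
           (\<lambda>n \<omega>. rho n (C n \<omega>) (T n \<omega>)
              - sqrt (real (m_pairs n (C n \<omega>)) / (\<integral>\<omega>'. real (m_pairs n (T n \<omega>')) \<partial>(M n)))) 0"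
proof -
  define \<mu> where "\<mu> n = (\<integral>\<omega>. real (m_pairs n (T n \<omega>)) \<partial>(M n))" for n
  have \<mu>_nonneg: "\<mu> n \<ge> 0" for n unfolding \<mu>_def by (rule Bochner_Integration.integral_nonneg) simp
  have \<mu>_pos: "eventually (\<lambda>n. \<mu> n > 0) sequentially"
    using landau_o.smallD[OF assms(5), of 1]
  proof (rule eventually_mono)
    show "\<mu> n > 0" if "norm (1::real) \<le> 1 * norm (\<integral>\<omega>. real (m_pairs n (T n \<omega>)) \<partial>M n)" for n
      using that \<mu>_nonneg[of n] by (simp add: \<mu>_def)
  qed simp
  define D where "D n \<omega> = rho n (C n \<omega>) (T n \<omega>) - sqrt (real (m_pairs n (C n \<omega>)) / \<mu> n)" for n \<omega>
  define R where "R n = {\<omega> \<in> space (M n). refines {1..n} (C n \<omega>) (T n \<omega>)}" for n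
  have "(\<lambda>n. measure (M n) {\<omega> \<in> space (M n). \<bar>D n \<omega> - 0\<bar> > \<epsilon>}) \<longlonglongrightarrow> 0" if \<epsilon>: "\<epsilon> > 0" for \<epsilon>
  proof -
    \<comment> \<open>With \<open>\<mu> \<le> \<delta> N\<close> and \<open>\<bar>m\<^sub>T / \<mu> - 1\<bar> \<le> \<delta>\<close>, the error bound is at most
      \<open>(1 + \<delta>) \<delta> + \<delta> < 3 \<delta> \<le> \<epsilon>\<close>; and \<open>\<delta> < 1/2\<close> gives \<open>0 < m\<^sub>T < N\<close>.\<close>
    define \<delta> where "\<delta> = min (1/3) (\<epsilon> / 3)"
    have \<delta>: "\<delta> > 0" "\<delta> < 1/2" "3 * \<delta> \<le> \<epsilon>" using \<epsilon> by (auto simp: \<delta>_def)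
    define B where "B n = {\<omega> \<in> space (M n). \<bar>real (m_pairs n (T n \<omega>)) / \<mu> n - 1\<bar> > \<delta>}" for n
    have setsR: "R n \<in> sets (M n)" for n
      unfolding R_def by (rule sets_Collect_random_partitions[OF assms(2,3)])
    have setsB: "B n \<in> sets (M n)" for n
      unfolding B_def by (rule sets_Collect_random_partitions[OF assms(2,3), 
          where P = "\<lambda>_ t. \<bar>real (m_pairs n t) / \<mu> n - 1\<bar> > \<delta>" for n])
    have limR: "(\<lambda>n. 1 - measure (M n) (R n)) \<longlonglongrightarrow> 0"
      using tendsto_diff[OF tendsto_const[of 1] assms(4)] by (simp add: R_def)
    have limB: "(\<lambda>n. measure (M n) (B n)) \<longlonglongrightarrow> 0"
      using assms(7) \<delta> unfolding tendsto_in_prob_def B_def \<mu>_def by blast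
    have union_bound: "eventually (\<lambda>n. measure (M n) {\<omega> \<in> space (M n). \<bar>D n \<omega> - 0\<bar> > \<epsilon>}
        \<le> (1 - measure (M n) (R n)) + measure (M n) (B n)) sequentially"
      using \<mu>_pos eventually_smallo_choose_two[OF assms(6) \<delta>(1)]
    proof eventually_elim
      case (elim n)
      interpret prob_space "M n" by (rule assms(1))
      let ?N = "real (n choose 2)"
      have \<mu>N: "\<mu> n \<le> \<delta> * ?N" using elim(2) by (simp add: \<mu>_def)
      have "{\<omega> \<in> space (M n). \<bar>D n \<omega> - 0\<bar> > \<epsilon>} \<subseteq> (space (M n) - R n) \<union> B n"
      proof (rule ccontr)
        assume "\<not> ?thesis"
        then obtain \<omega> where \<omega>: "\<omega> \<in> R n" "\<omega> \<in> space (M n)" "\<omega> \<notin> B n" "\<bar>D n \<omega>\<bar> > \<epsilon>" by auto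
        define t where "t = real (m_pairs n (T n \<omega>))"
        have ratio: "\<bar>t / \<mu> n - 1\<bar> \<le> \<delta>" using \<omega>(2,3) by (auto simp: B_def t_def)
        then have bounds: "1 - \<delta> \<le> t / \<mu> n" "t / \<mu> n \<le> 1 + \<delta>" by linarith+
        have t_pos: "0 < t"
        proof (rule ccontr)
          assume "\<not> 0 < t"
          then have "t / \<mu> n \<le> 0" using elim(1) by (simp add: divide_nonpos_pos)
          then show False using bounds \<delta> by linarith
        qed
        have N_pos: "0 < ?N" using \<mu>N elim(1) \<delta>(1) by (smt (verit) mult_nonneg_nonpos)
        have "t \<le> (1 + \<delta>) * \<mu> n" using bounds elim(1) by (simp add: divide_le_eq)
        also have "\<dots> \<le> (1 + \<delta>) * (\<delta> * ?N)" using \<mu>N \<delta> by (intro mult_left_mono) auto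
        finally have tN: "t / ?N \<le> \<delta> + \<delta> * \<delta>"
          using N_pos by (simp add: divide_le_eq algebra_simps)
        have \<delta>2: "\<delta> * \<delta> < \<delta> * (1/2)" using \<delta> by (intro mult_strict_left_mono) auto
        have "t / ?N < 1" using tN \<delta> \<delta>2 by linarith
        then have "t < ?N" using N_pos by (simp add: divide_less_eq)
        then have "\<bar>D n \<omega>\<bar> \<le> t / ?N + \<bar>t / \<mu> n - 1\<bar>"
          unfolding D_def t_def using \<omega>(1) t_pos elim(1)
          by (intro rho_refinement_error) (auto simp: R_def t_def)
        also have "\<dots> < 3 * \<delta>" using tN ratio \<delta> \<delta>2 by linarith
        finally show False using \<omega>(4) \<delta> by linarith
      qed
      then have "prob {\<omega> \<in> space (M n). \<bar>D n \<omega> - 0\<bar> > \<epsilon>} \<le> prob ((space (M n) - R n) \<union> B n)"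
        using setsR setsB by (intro finite_measure_mono) auto
      also have "\<dots> \<le> prob (space (M n) - R n) + prob (B n)"
        using setsR setsB by (intro measure_Un_le) auto
      also have "prob (space (M n) - R n) = 1 - prob (R n)" by (rule prob_compl[OF setsR])
      finally show ?case .
    qed
    have lim: "(\<lambda>n. (1 - measure (M n) (R n)) + measure (M n) (B n)) \<longlonglongrightarrow> 0"
      using tendsto_add[OF limR limB] by simp
    show ?thesis
      by (rule tendsto_sandwich[OF always_eventually union_bound tendsto_const lim])
        (rule allI, rule measure_nonneg)
  qed
  then show ?thesis unfolding tendsto_in_prob_def D_def \<mu>_def by simp
qed

end
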